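(* The envy-free perfect matching problem with qualities of items can be solved in $O(n^2)$ time. That is, there is an algorithm which, given as input an integer $n \ge 1$, budgets $v_1,\dots,v_n > 0$ of the $n$ buyers and quality measures $q_1,\dots,q_n > 0$ of the $n$ items, outputs in $O(n^2)$ time an optimal envy-free allocation together with optimal envy-free prices, i.e. an optimal solution $(x,p)$ of the problem for the valuations $v_{i,j} = v_i q_j$.
   Context: The envy-free perfect matching problem with qualities of items. There are $n$ buyers, each with unit demand, and $n$ items, each with unit supply. Buyer $i$ has a budget $v_i>0$, item $j$ has a quality measure $q_j>0$, and the valuation of buyer $i$ for item $j$ is $v_{i,j} = v_i q_j$. The budgets and qualities are not assumed to be sorted. A feasible solution is a pair $(x,p)$ such that: (1) $x=(x_{i,j})\in\{0,1\}^{n\times n}$ is a perfect matching of buyers and items, i.e. $\sum_{j=1}^n x_{i,j}=1$ for every $i$ and $\sum_{i=1}^n x_{i,j}=1$ for every $j$ (here $x_{i,j}=1$ means that buyer $i$ buys item $j$; all items must be sold); (2) $p=(p_1,\dots,p_n)\in\mathbb{R}^n$ is a vector of item prices such that, whenever $x_{i,j}=1$, one has $v_{i,j}\ge p_j$ (nonnegative surplus) and $v_{i,j}-p_j\ge v_{i,k}-p_k$ for all $k\ne j$ (envy-freeness). An optimal solution (an optimal envy-free allocation $x$ with optimal envy-free prices $p$) is a feasible solution $(x,p)$ maximizing the seller's revenue $\sum_{j=1}^n p_j$ over all feasible solutions. Running time counts elementary operations, where each arithmetic operation ($+$, $-$, $\times$) and each comparison of two real numbers has unit cost. *)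

theory Defs
  imports Complex_Main "HOL-Library.Landau_Symbols"
begin

text \<open>Buyers and items are both numbered \<open>0, \<dots>, n - 1\<close>; values of \<open>w\<close>, \<open>x\<close>, \<open>p\<close> outside
  this range are irrelevant. \<open>w i j\<close> is the valuation of buyer \<open>i\<close> for item \<open>j\<close>.\<close>

definition perfect_matching :: "nat \<Rightarrow> (nat \<Rightarrow> nat \<Rightarrow> nat) \<Rightarrow> bool" where
  "perfect_matching n x \<longleftrightarrow>
     (\<forall>i<n. \<forall>j<n. x i j \<in> {0, 1}) \<and>
     (\<forall>i<n. (\<Sum>j<n. x i j) = 1) \<and>
     (\<forall>j<n. (\<Sum>i<n. x i j) = 1)"

definition feasible ::
  "nat \<Rightarrow> (nat \<Rightarrow> nat \<Rightarrow> real) \<Rightarrow> (nat \<Rightarrow> nat \<Rightarrow> nat) \<Rightarrow> (nat \<Rightarrow> real) \<Rightarrow> bool" where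
  "feasible n w x p \<longleftrightarrow>
     perfect_matching n x \<and>
     (\<forall>i<n. \<forall>j<n. x i j = 1 \<longrightarrow>
        w i j \<ge> p j \<and>
        (\<forall>k<n. k \<noteq> j \<longrightarrow> w i j - p j \<ge> w i k - p k))"

definition optimal ::
  "nat \<Rightarrow> (nat \<Rightarrow> nat \<Rightarrow> real) \<Rightarrow> (nat \<Rightarrow> nat \<Rightarrow> nat) \<Rightarrow> (nat \<Rightarrow> real) \<Rightarrow> bool" where
  "optimal n w x p \<longleftrightarrow>
     feasible n w x p \<and>
     (\<forall>x' p'. feasible n w x' p' \<longrightarrow> (\<Sum>j<n. p' j) \<le> (\<Sum>j<n. p j))"

text \<open>Algorithms are programs of a small imperative language for a real random access machine.
  A program works on finitely many named arrays of natural numbers (indices, counters, 0/1 flags)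
  and of reals; a scalar variable is the cell at index 0 of an array. Reals support only
  \<open>+\<close>, \<open>-\<close>, \<open>*\<close> and comparison, starting from the input and integer constants; there is no
  rounding or other conversion between reals and naturals. Naturals support
  only \<open>+\<close>, truncated \<open>-\<close> and comparison: without multiplication, unit cost for
  index arithmetic is harmless.\<close>

record state =
  nmem :: "string \<Rightarrow> nat \<Rightarrow> nat"
  rmem :: "string \<Rightarrow> nat \<Rightarrow> real"

datatype nexp =
    NConst nat
  | NGet string nexp
  | NAdd nexp nexp
  | NSub nexp nexp

datatype rexp =
    RConst int
  | RGet string nexp
  | RAdd rexp rexp
  | RSub rexp rexp
  | RMul rexp rexp

datatype bexp =
    NLess nexp nexp
  | RLess rexp rexp
  | BNot bexp
  | BAnd bexp bexp

datatype com =
    Skip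
  | NSet string nexp nexp
  | RSet string nexp rexp
  | Seq com com
  | Cond bexp com com
  | While bexp com

primrec nval :: "nexp \<Rightarrow> state \<Rightarrow> nat" where
  "nval (NConst k) s = k"
| "nval (NGet a e) s = nmem s a (nval e s)"
| "nval (NAdd e f) s = nval e s + nval f s"
| "nval (NSub e f) s = nval e s - nval f s"

primrec rval :: "rexp \<Rightarrow> state \<Rightarrow> real" where
  "rval (RConst k) s = of_int k"
| "rval (RGet a e) s = rmem s a (nval e s)"
| "rval (RAdd e f) s = rval e s + rval f s"
| "rval (RSub e f) s = rval e s - rval f s"
| "rval (RMul e f) s = rval e s * rval f s"

primrec bval :: "bexp \<Rightarrow> state \<Rightarrow> bool" where
  "bval (NLess e f) s \<longleftrightarrow> nval e s < nval f s"
| "bval (RLess e f) s \<longleftrightarrow> rval e s < rval f s"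
| "bval (BNot b) s \<longleftrightarrow> \<not> bval b s"
| "bval (BAnd b c) s \<longleftrightarrow> bval b s \<and> bval c s"

text \<open>Not only arithmetic and comparisons but also loading a constant, reading or
  writing a cell, logical connectives and \<open>Skip\<close> cost one unit each.\<close>

primrec ncost :: "nexp \<Rightarrow> nat" where
  "ncost (NConst k) = 1"
| "ncost (NGet a e) = 1 + ncost e"
| "ncost (NAdd e f) = 1 + ncost e + ncost f"
| "ncost (NSub e f) = 1 + ncost e + ncost f"

primrec rcost :: "rexp \<Rightarrow> nat" where
  "rcost (RConst k) = 1"
| "rcost (RGet a e) = 1 + ncost e"
| "rcost (RAdd e f) = 1 + rcost e + rcost f"
| "rcost (RSub e f) = 1 + rcost e + rcost f"
| "rcost (RMul e f) = 1 + rcost e + rcost f"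

primrec bcost :: "bexp \<Rightarrow> nat" where
  "bcost (NLess e f) = 1 + ncost e + ncost f"
| "bcost (RLess e f) = 1 + rcost e + rcost f"
| "bcost (BNot b) = 1 + bcost b"
| "bcost (BAnd b c) = 1 + bcost b + bcost c"

definition nwrite :: "string \<Rightarrow> nat \<Rightarrow> nat \<Rightarrow> state \<Rightarrow> state" where
  "nwrite a i k s = s\<lparr>nmem := (nmem s)(a := (nmem s a)(i := k))\<rparr>"

definition rwrite :: "string \<Rightarrow> nat \<Rightarrow> real \<Rightarrow> state \<Rightarrow> state" where
  "rwrite a i r s = s\<lparr>rmem := (rmem s)(a := (rmem s a)(i := r))\<rparr>"

text \<open>\<open>exec c s t s'\<close>: started in \<open>s\<close>, the program \<open>c\<close> halts in \<open>s'\<close> after exactly \<open>t\<close> elementary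
  operations.\<close>

inductive exec :: "com \<Rightarrow> state \<Rightarrow> nat \<Rightarrow> state \<Rightarrow> bool" where
  Skip: "exec Skip s 1 s"
| NSet: "exec (NSet a e f) s (1 + ncost e + ncost f) (nwrite a (nval e s) (nval f s) s)"
| RSet: "exec (RSet a e f) s (1 + ncost e + rcost f) (rwrite a (nval e s) (rval f s) s)"
| Seq: "exec c s t s' \<Longrightarrow> exec d s' u s'' \<Longrightarrow> exec (Seq c d) s (t + u) s''"
| CondTrue: "bval b s \<Longrightarrow> exec c s t s' \<Longrightarrow> exec (Cond b c d) s (bcost b + t) s'"
| CondFalse: "\<not> bval b s \<Longrightarrow> exec d s t s' \<Longrightarrow> exec (Cond b c d) s (bcost b + t) s'"
| WhileFalse: "\<not> bval b s \<Longrightarrow> exec (While b c) s (bcost b) s"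
| WhileTrue: "bval b s \<Longrightarrow> exec c s t s' \<Longrightarrow> exec (While b c) s' u s'' \<Longrightarrow>
    exec (While b c) s (bcost b + t + u) s''"

inductive_cases SkipE: "exec Skip s t s'"
inductive_cases NSetE: "exec (NSet a e f) s t s'"
inductive_cases RSetE: "exec (RSet a e f) s t s'"
inductive_cases SeqE: "exec (Seq c d) s t s'"
inductive_cases CondE: "exec (Cond b c d) s t s'"
inductive_cases WhileE: "exec (While b c) s t s'"

lemma exec_deterministic:
  "exec c s t s' \<Longrightarrow> exec c s u s'' \<Longrightarrow> t = u \<and> s' = s''"
proof (induction arbitrary: u s'' rule: exec.induct)
  case (Seq c s t s' d u' s2)
  then show ?case by (metis SeqE)
next
  case (CondTrue b s c t s' d)
  then show ?case by (metis CondE)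
next
  case (CondFalse b s d t s' c)
  then show ?case by (metis CondE)
next
  case (WhileFalse b s c)
  then show ?case by (metis WhileE)
next
  case (WhileTrue b s c t s' u' s2)
  from WhileTrue.prems WhileTrue.hyps(1) obtain t1 s1 u1 where
    "u = bcost b + t1 + u1" "exec c s t1 s1" "exec (While b c) s1 u1 s''"
    by (metis WhileE)
  with WhileTrue.IH show ?case by blast
qed (auto elim: SkipE NSetE RSetE)

text \<open>The size is given in the scalar \<open>n\<close> and the budgets and qualities in the real arrays
  \<open>v\<close> and \<open>q\<close>; all other cells are initially zero. On termination the matching is read off,
  row by row, from the array \<open>x\<close> of naturals, and the prices from the real array \<open>p\<close>.\<close>

definition input_state :: "nat \<Rightarrow> (nat \<Rightarrow> real) \<Rightarrow> (nat \<Rightarrow> real) \<Rightarrow> state" where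
  "input_state n v q =
     \<lparr>nmem = (\<lambda>a i. if a = ''n'' \<and> i = 0 then n else 0),
      rmem = (\<lambda>a i. if a = ''v'' \<and> i < n then v i
                    else if a = ''q'' \<and> i < n then q i
                    else 0)\<rparr>"

definition output_matching :: "nat \<Rightarrow> state \<Rightarrow> nat \<Rightarrow> nat \<Rightarrow> nat" where
  "output_matching n s = (\<lambda>i j. nmem s ''x'' (i * n + j))"

definition output_prices :: "state \<Rightarrow> nat \<Rightarrow> real" where
  "output_prices s = rmem s ''p''"

end

theory Submission
  imports Defs
begin

text \<open>Envy-freeness forces a matching that is monotone in budget and quality. Index buyers and
  items by their ranks, so that budgets \<open>V\<close> and qualities \<open>Q\<close> are increasing. Then
  the price increment from the item of rank \<open>k - 1\<close> to that of rank \<open>k\<close> is at most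
  \<open>V k * (Q k - Q (k - 1))\<close>, with \<open>Q (- 1) = 0\<close> accounting for the nonnegative
  surplus of the poorest buyer, and taking equality throughout is envy-free. Computing all
  ranks by counting smaller elements takes quadratic time, the prices then take linear time.\<close>

section \<open>Optimal prices for sorted budgets and qualities\<close>

text \<open>\<open>case_nat 0 Q l\<close> is the next lower quality, with 0 below the lowest rank.
  The item of rank \<open>k\<close> costs \<open>price V Q (Suc k)\<close>, so
  \<open>price V Q k\<close> is what has accumulated before rank \<open>k\<close> is
  treated.\<close>

definition price :: "(nat \<Rightarrow> real) \<Rightarrow> (nat \<Rightarrow> real) \<Rightarrow> nat \<Rightarrow> real" where
  "price V Q k = (\<Sum>l<k. V l * (Q l - case_nat 0 Q l))"

lemma price_0 [simp]: "price V Q 0 = 0"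
  by (simp add: price_def)

lemma price_Suc: "price V Q (Suc k) = price V Q k + V k * (Q k - case_nat 0 Q k)"
  by (simp add: price_def)

text \<open>Increments past rank \<open>k\<close> are weighted by budgets of at least
  \<open>V k\<close>, and the quality differences telescope. This excludes envy of better
  items.\<close>

lemma price_increment_ge:
  assumes V: "mono_on {..<n} V" and Q: "mono_on {..<n} Q"
  shows "k \<le> m \<Longrightarrow> m < n \<Longrightarrow>
    price V Q (Suc m) - price V Q (Suc k) \<ge> V k * (Q m - Q k)"
proof (induction m rule: dec_induct)
  case (step m)
  have "V k \<le> V (Suc m)" "Q m \<le> Q (Suc m)"
    using step mono_onD[OF V, of k "Suc m"] mono_onD[OF Q, of m "Suc m"] by auto
  then have "V k * (Q (Suc m) - Q m) \<le> V (Suc m) * (Q (Suc m) - Q m)"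
    by (intro mult_right_mono) auto
  then show ?case using step by (simp add: price_Suc[of _ _ "Suc m"] algebra_simps)
qed simp

text \<open>Dually, increments up to rank \<open>k\<close> are weighted by budgets of at most
  \<open>V k\<close>, which excludes envy of worse items.\<close>

lemma price_increment_le:
  assumes V: "mono_on {..<n} V" and Q: "mono_on {..<n} Q"
  shows "m \<le> k \<Longrightarrow> k < n \<Longrightarrow>
    price V Q (Suc k) - price V Q (Suc m) \<le> V k * (Q k - Q m)"
proof (induction k rule: dec_induct)
  case (step k)
  have "V k \<le> V (Suc k)" "Q m \<le> Q k"
    using step mono_onD[OF V, of k "Suc k"] mono_onD[OF Q, of m k] by auto
  then have "V k * (Q k - Q m) \<le> V (Suc k) * (Q k - Q m)"
    by (intro mult_right_mono) auto
  then show ?case using step by (simp add: price_Suc[of _ _ "Suc k"] algebra_simps)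
qed simp

lemma price_envy_free:
  assumes "mono_on {..<n} V" "mono_on {..<n} Q" "k < n" "m < n"
  shows "V k * Q k - price V Q (Suc k) \<ge> V k * Q m - price V Q (Suc m)"
  using price_increment_ge[OF assms(1,2), of k m] price_increment_le[OF assms(1,2), of m k] assms
  by (cases "k \<le> m") (auto simp: algebra_simps)

text \<open>The lowest item costs \<open>V 0 * Q 0\<close>, at most \<open>V k * Q 0\<close> because
  \<open>Q 0\<close> is positive; the increments up to rank \<open>k\<close> add at most
  \<open>V k * (Q k - Q 0)\<close>.\<close>

lemma price_individually_rational:
  assumes V: "mono_on {..<n} V" and Q: "mono_on {..<n} Q"
    and "\<And>k. k < n \<Longrightarrow> Q k > 0" and k: "k < n"
  shows "price V Q (Suc k) \<le> V k * Q k"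
proof -
  have "V 0 * Q 0 \<le> V k * Q 0"
    using assms(3)[of 0] k mono_onD[OF V, of 0 k] by (intro mult_right_mono) auto
  then show ?thesis
    using price_increment_le[OF V Q, of 0 k] k by (simp add: price_Suc algebra_simps)
qed

text \<open>Here \<open>\<pi> k\<close> is the rank of the buyer who gets the item of rank
  \<open>k\<close> under arbitrary envy-free prices \<open>P\<close>. In the induction, a buyer with
  budget at most \<open>V k\<close> who holds an equivalent of item \<open>k\<close> limits the
  price increase over the previous item.\<close>

lemma price_maximal:
  assumes V: "mono_on {..<n} V" and Q: "mono_on {..<n} Q"
    and Qpos: "\<And>k. k < n \<Longrightarrow> Q k > 0"
    and perm: "bij_betw \<pi> {..<n} {..<n}"
    and rational: "\<And>k. k < n \<Longrightarrow> P k \<le> V (\<pi> k) * Q k"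
    and ef: "\<And>k m. k < n \<Longrightarrow> m < n \<Longrightarrow> V (\<pi> k) * Q k - P k \<ge> V (\<pi> k) * Q m - P m"
  shows "k < n \<Longrightarrow> P k \<le> price V Q (Suc k)"
proof (induction k)
  \<comment> \<open>With ties the buyer of item \<open>k\<close> may be richer than
    \<open>V k\<close>; then another item of the same quality and price has to serve.\<close>
  have *: "\<exists>m<n. V (\<pi> m) \<le> V k \<and> Q m = Q k \<and> P m = P k" if k: "k < n" for k
  proof -
    \<comment> \<open>Pigeonhole: the \<open>n - k\<close> items of rank at least \<open>k\<close>
      cannot all go to the \<open>n - k - 1\<close> buyers of rank above \<open>k\<close>.\<close>
    have "\<exists>m\<in>{k..<n}. \<pi> m \<le> k"
    proof (rule ccontr)
      assume "\<not> ?thesis"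
      moreover have "\<pi> m < n" if "m < n" for m
        using perm that by (auto simp: bij_betw_def)
      ultimately have "\<pi> ` {k..<n} \<subseteq> {Suc k..<n}" by (auto simp: not_le Suc_le_eq)
      moreover have "inj_on \<pi> {k..<n}"
        using perm by (auto simp: bij_betw_def intro: inj_on_subset)
      ultimately have "card {k..<n} \<le> card {Suc k..<n}"
        by (metis card_inj_on_le finite_atLeastLessThan)
      then show False using k by simp
    qed
    then obtain m where m: "k \<le> m" "m < n" "\<pi> m \<le> k" by auto
    have Vm: "V (\<pi> m) \<le> V k" using mono_onD[OF V, of "\<pi> m" k] m k by auto
    show ?thesis
    proof (cases "Q m = Q k")
      case True
      then have "P m = P k" using ef[OF k m(2)] ef[OF m(2) k] by simp
      then show ?thesis using True Vm m by blast
    next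
      case False
      then have "Q k < Q m" using mono_onD[OF Q, of k m] m k by auto
      \<comment> \<open>Adding the two no-envy inequalities shows that the buyer of item
        \<open>k\<close> is no richer than that of item \<open>m\<close>, so \<open>k\<close> itself
        is the witness.\<close>
      moreover have "(V (\<pi> m) - V (\<pi> k)) * (Q m - Q k) \<ge> 0"
        using ef[OF k m(2)] ef[OF m(2) k] by (simp add: algebra_simps)
      ultimately have "V (\<pi> k) \<le> V (\<pi> m)" by (simp add: zero_le_mult_iff)
      then show ?thesis using Vm k by auto
    qed
  qed
  {
    case 0
    then obtain m where "m < n" "V (\<pi> m) \<le> V 0" "Q m = Q 0" "P m = P 0" using * by blast
    moreover have "V (\<pi> m) * Q 0 \<le> V 0 * Q 0"
      using calculation Qpos[of 0] 0 by (intro mult_right_mono) auto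
    ultimately show ?case using rational[of m] by (simp add: price_Suc)
  next
    case (Suc k)
    obtain m where m: "m < n" "V (\<pi> m) \<le> V (Suc k)" "Q m = Q (Suc k)" "P m = P (Suc k)"
      using * Suc.prems by blast
    \<comment> \<open>The buyer of item \<open>m\<close> does not envy item \<open>k\<close>, so the
      price rises by at most this buyer's budget times the quality gap.\<close>
    moreover have "V (\<pi> m) * (Q (Suc k) - Q k) \<le> V (Suc k) * (Q (Suc k) - Q k)"
      using m Suc.prems mono_onD[OF Q, of k "Suc k"] by (intro mult_right_mono) auto
    ultimately show ?case
      using ef[of m k] Suc by (simp add: price_Suc[of _ _ "Suc k"] algebra_simps)
  }
qed

section \<open>Perfect matchings as bijections and reindexing by ranks\<close>

text \<open>\<open>\<tau>\<close> sends each item to its buyer: column sums give existence, row sums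
  injectivity, and finiteness surjectivity.\<close>

lemma perfect_matching_bij:
  assumes "perfect_matching n x"
  obtains \<tau> where "bij_betw \<tau> {..<n} {..<n}" "\<And>j. j < n \<Longrightarrow> x (\<tau> j) j = 1"
proof -
  have x01: "x i j = 0 \<or> x i j = 1" if "i < n" "j < n" for i j
    using assms that by (auto simp: perfect_matching_def)
  have "\<exists>i<n. x i j = 1" if "j < n" for j
  proof (rule ccontr)
    assume "\<not> ?thesis"
    then have "(\<Sum>i<n. x i j) = 0" using x01 that by auto
    then show False using assms that by (auto simp: perfect_matching_def)
  qed
  then obtain \<tau> where \<tau>: "\<And>j. j < n \<Longrightarrow> \<tau> j < n \<and> x (\<tau> j) j = 1" by metis
  have "inj_on \<tau> {..<n}"
  proof (rule inj_onI, rule ccontr)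
    fix j k assume jk: "j \<in> {..<n}" "k \<in> {..<n}" "\<tau> j = \<tau> k" "j \<noteq> k"
    have "(\<Sum>l\<in>{j, k}. x (\<tau> j) l) \<le> (\<Sum>l<n. x (\<tau> j) l)"
      using jk by (intro sum_mono2) auto
    moreover have "(\<Sum>l<n. x (\<tau> j) l) = 1"
      using assms \<tau> jk by (auto simp: perfect_matching_def)
    moreover have "x (\<tau> j) j = 1" "x (\<tau> j) k = 1" using \<tau>[of j] \<tau>[of k] jk by auto
    ultimately show False using jk by simp
  qed
  moreover have "\<tau> ` {..<n} \<subseteq> {..<n}" using \<tau> by auto
  ultimately have "bij_betw \<tau> {..<n} {..<n}"
    by (simp add: bij_betw_def endo_inj_surj)
  then show thesis using that \<tau> by blast
qed

lemma sum_bij_indicator: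
  fixes n :: nat
  assumes "bij_betw \<sigma> {..<n} {..<n}" "k < n"
  shows "(\<Sum>j<n. if \<sigma> j = k then 1 else 0 :: nat) = 1"
proof -
  obtain j where j: "j < n" "\<sigma> j = k"
    using assms unfolding bij_betw_def by (metis imageE lessThan_iff)
  then have "{..<n} \<inter> {i. \<sigma> i = k} = {j}"
    using assms by (auto simp: bij_betw_def inj_on_def)
  then show ?thesis by (simp add: sum.If_cases)
qed

text \<open>Reindexing by the ranks \<open>\<rho>\<close> and \<open>\<sigma>\<close> reduces the
  general case to sorted data. Every single price is maximal among all feasible solutions, hence so
  is the revenue.\<close>

lemma optimal_rank_matching:
  assumes V: "mono_on {..<n} V" and Q: "mono_on {..<n} Q"
    and Qpos: "\<And>k. k < n \<Longrightarrow> Q k > 0"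
    and \<rho>: "bij_betw \<rho> {..<n} {..<n}" and \<sigma>: "bij_betw \<sigma> {..<n} {..<n}"
    and v: "\<And>i. i < n \<Longrightarrow> v i = V (\<rho> i)" and q: "\<And>j. j < n \<Longrightarrow> q j = Q (\<sigma> j)"
    and x: "\<And>i j. i < n \<Longrightarrow> j < n \<Longrightarrow> x i j = (if \<rho> i = \<sigma> j then 1 else 0)"
    and p: "\<And>j. j < n \<Longrightarrow> p j = price V Q (Suc (\<sigma> j))"
  shows "optimal n (\<lambda>i j. v i * q j) x p"
proof -
  have less: "\<rho> i < n" "\<sigma> i < n" if "i < n" for i
    using \<rho> \<sigma> that by (auto simp: bij_betw_def)
  have "(\<Sum>j<n. x i j) = 1" if "i < n" for i
    using sum_bij_indicator[OF \<sigma> less(1)[OF that]] that by (simp add: x eq_commute)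
  moreover have "(\<Sum>i<n. x i j) = 1" if "j < n" for j
    using sum_bij_indicator[OF \<rho> less(2)[OF that]] that by (simp add: x)
  ultimately have pm: "perfect_matching n x" by (auto simp: perfect_matching_def x)
  have feas: "feasible n (\<lambda>i j. v i * q j) x p"
    unfolding feasible_def
    using pm price_envy_free[OF V Q] price_individually_rational[OF V Q Qpos] less
    by (auto simp: x v q p split: if_splits)
  have "(\<Sum>j<n. p' j) \<le> (\<Sum>j<n. p j)" if f: "feasible n (\<lambda>i j. v i * q j) x' p'" for x' p'
  proof -
    obtain \<tau> where \<tau>: "bij_betw \<tau> {..<n} {..<n}" "\<And>j. j < n \<Longrightarrow> x' (\<tau> j) j = 1"
      using perfect_matching_bij f unfolding feasible_def by metis
    define \<alpha> where "\<alpha> = inv_into {..<n} \<sigma>"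
    have \<alpha>: "bij_betw \<alpha> {..<n} {..<n}" "\<And>k. k < n \<Longrightarrow> \<sigma> (\<alpha> k) = k"
      "\<And>j. j < n \<Longrightarrow> \<alpha> (\<sigma> j) = j"
      using \<sigma> unfolding \<alpha>_def
      by (auto simp: bij_betw_inv_into bij_betw_inv_into_left bij_betw_inv_into_right)
    have \<alpha>n: "\<alpha> k < n" and \<tau>n: "\<tau> k < n" if "k < n" for k
      using \<alpha>(1) \<tau>(1) that by (auto simp: bij_betw_def)
    \<comment> \<open>From the rank of an item to the item, to its buyer in the competing matching,
      to the rank of that buyer.\<close>
    define \<pi> where "\<pi> = \<rho> \<circ> (\<tau> \<circ> \<alpha>)"
    have \<pi>: "bij_betw \<pi> {..<n} {..<n}"
      unfolding \<pi>_def by (intro bij_betw_trans[OF bij_betw_trans[OF \<alpha>(1) \<tau>(1)] \<rho>])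
    have surplus: "p' j \<le> v (\<tau> j) * q j" if "j < n" for j
      using f \<tau>(2) \<tau>n that by (auto simp: feasible_def)
    have ef: "v (\<tau> j) * q j - p' j \<ge> v (\<tau> j) * q k - p' k" if "j < n" "k < n" for j k
      using f \<tau>(2)[OF that(1)] \<tau>n[OF that(1)] that by (cases "k = j") (auto simp: feasible_def)
    have "p' (\<alpha> k) \<le> price V Q (Suc k)" if "k < n" for k
    proof (rule price_maximal[OF V Q Qpos \<pi> _ _ that, where P = "\<lambda>k. p' (\<alpha> k)"])
      show "p' (\<alpha> k) \<le> V (\<pi> k) * Q k" if "k < n" for k
        using surplus[OF \<alpha>n[OF that]] that \<alpha>n \<tau>n by (simp add: \<pi>_def v q \<alpha>)
      show "V (\<pi> k) * Q m - p' (\<alpha> m) \<le> V (\<pi> k) * Q k - p' (\<alpha> k)" if "k < n" "m < n" for k m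
        using ef[OF \<alpha>n[OF that(1)] \<alpha>n[OF that(2)]] that \<alpha>n \<tau>n by (simp add: \<pi>_def v q \<alpha>)
    qed
    then have "p' j \<le> p j" if "j < n" for j
      using less(2)[OF that] that \<alpha>(3)[OF that] p by metis
    then show ?thesis by (intro sum_mono) auto
  qed
  then show ?thesis using feas by (simp add: optimal_def)
qed

section \<open>Ranks\<close>

text \<open>Ties are broken by the index, which makes ranks distinct.\<close>

definition before :: "(nat \<Rightarrow> real) \<Rightarrow> nat \<Rightarrow> nat \<Rightarrow> bool" where
  "before w j i \<longleftrightarrow> w j < w i \<or> w j = w i \<and> j < i"

definition rank :: "nat \<Rightarrow> (nat \<Rightarrow> real) \<Rightarrow> nat \<Rightarrow> nat" where
  "rank n w i = card {j. j < n \<and> before w j i}"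

text \<open>By transitivity the predecessors of \<open>j\<close> are predecessors of
  \<open>i\<close>; the inclusion is strict since \<open>j\<close> precedes \<open>i\<close> but not
  itself.\<close>

lemma rank_strict_mono:
  assumes "before w j i" "j < n"
  shows "rank n w j < rank n w i"
  unfolding rank_def
proof (rule psubset_card_mono)
  show "{l. l < n \<and> before w l j} \<subset> {l. l < n \<and> before w l i}"
    using assms by (force simp: before_def)
qed simp

lemma rank_less: "i < n \<Longrightarrow> rank n w i < n"
proof -
  assume "i < n"
  then have "{j. j < n \<and> before w j i} \<subset> {..<n}" by (force simp: before_def)
  then show ?thesis unfolding rank_def by (metis card_lessThan finite_lessThan psubset_card_mono)
qed

lemma before_total: "i \<noteq> j \<Longrightarrow> before w i j \<or> before w j i"
  by (auto simp: before_def)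

lemma rank_inj: "inj_on (rank n w) {..<n}"
  by (rule inj_onI) (metis before_total lessThan_iff less_irrefl rank_strict_mono)

lemma rank_bij: "bij_betw (rank n w) {..<n} {..<n}"
proof -
  have "rank n w ` {..<n} \<subseteq> {..<n}" using rank_less by auto
  then show ?thesis by (simp add: bij_betw_def rank_inj endo_inj_surj)
qed

text \<open>Ranks exhaust the indices below \<open>n\<close>, and a descent of \<open>V\<close>
  would contradict the order of the ranks.\<close>

lemma mono_on_sorted:
  assumes "\<And>i. i < n \<Longrightarrow> V (rank n w i) = w i"
  shows "mono_on {..<n} V"
proof (rule mono_onI)
  fix k m assume km: "k \<in> {..<n}" "m \<in> {..<n}" "k \<le> m"
  then obtain i j where ij: "i < n" "j < n" "k = rank n w i" "m = rank n w j"
    using rank_bij[of n w] unfolding bij_betw_def by (metis imageE lessThan_iff)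
  then have "\<not> before w j i" using km rank_strict_mono[of w j i n] by auto
  then show "V k \<le> V m" using assms ij by (auto simp: before_def)
qed

section \<open>Execution with a time bound\<close>

text \<open>Total correctness with an upper bound instead of the exact cost, so that costs can be
  rounded up.\<close>

definition runs :: "com \<Rightarrow> state \<Rightarrow> nat \<Rightarrow> (state \<Rightarrow> bool) \<Rightarrow> bool" where
  "runs c s T R \<longleftrightarrow> (\<exists>t s'. exec c s t s' \<and> t \<le> T \<and> R s')"

lemma runs_conseq: "runs c s T R \<Longrightarrow> T \<le> T' \<Longrightarrow> (\<And>s'. R s' \<Longrightarrow> R' s') \<Longrightarrow> runs c s T' R'"
  unfolding runs_def using le_trans by blast

lemma runs_time: "runs c s T R \<Longrightarrow> T \<le> T' \<Longrightarrow> runs c s T' R"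
  by (rule runs_conseq)

lemma runs_Skip: "R s \<Longrightarrow> runs Skip s 1 R"
  unfolding runs_def using exec.Skip by blast

lemma runs_NSet:
  "R (nwrite a (nval e s) (nval f s) s) \<Longrightarrow> runs (NSet a e f) s (1 + ncost e + ncost f) R"
  unfolding runs_def using exec.NSet by blast

lemma runs_RSet:
  "R (rwrite a (nval e s) (rval f s) s) \<Longrightarrow> runs (RSet a e f) s (1 + ncost e + rcost f) R"
  unfolding runs_def using exec.RSet by blast

text \<open>Nesting \<open>runs\<close> in the postcondition avoids intermediate assertions: chains
  of assignments are executed symbolically.\<close>

lemma runs_Seq:
  "runs c s T (\<lambda>s'. runs d s' U R) \<Longrightarrow> runs (Seq c d) s (T + U) R"
  unfolding runs_def using exec.Seq add_mono by meson

lemma runs_Cond: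
  assumes "bval b s \<Longrightarrow> runs c s T R" "\<not> bval b s \<Longrightarrow> runs d s U R"
  shows "runs (Cond b c d) s (bcost b + (T + U)) R"
proof (cases "bval b s")
  case True
  then obtain t s' where "exec c s t s'" "t \<le> T" "R s'"
    using assms(1) unfolding runs_def by blast
  then show ?thesis
    using exec.CondTrue[OF True, of c t s' d] unfolding runs_def
    by (intro exI[of _ "bcost b + t"] exI[of _ s']) auto
next
  case False
  then obtain t s' where "exec d s t s'" "t \<le> U" "R s'"
    using assms(2) unfolding runs_def by blast
  then show ?thesis
    using exec.CondFalse[OF False, of d t s' c] unfolding runs_def
    by (intro exI[of _ "bcost b + t"] exI[of _ s']) auto
qed

lemma runs_While:
  assumes body: "\<And>k s. k < n \<Longrightarrow> I k s \<Longrightarrow> bval b s \<and> runs c s T (I (Suc k))"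
    and exit: "\<And>s. I n s \<Longrightarrow> \<not> bval b s"
    and init: "I 0 s"
  shows "runs (While b c) s (n * (bcost b + T) + bcost b) (I n)"
proof -
  \<comment> \<open>Generalised to a start after \<open>k\<close> iterations, for induction on the
    number of remaining ones.\<close>
  have "I k s \<Longrightarrow> k \<le> n \<Longrightarrow> runs (While b c) s ((n - k) * (bcost b + T) + bcost b) (I n)" for k
  proof (induction "n - k" arbitrary: k s)
    case 0
    then have "I n s" by simp
    then show ?case using 0 exec.WhileFalse[OF exit] unfolding runs_def by auto
  next
    case (Suc m)
    then have "k < n" by simp
    then obtain t s' where s': "bval b s" "exec c s t s'" "t \<le> T" "I (Suc k) s'"
      using body Suc.prems(1) unfolding runs_def by blast
    have "m = n - Suc k" "Suc k \<le> n" using Suc.hyps(2) by auto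
    then obtain u s'' where "exec (While b c) s' u s''" "I n s''" "u \<le> m * (bcost b + T) + bcost b"
      using Suc.hyps(1)[OF _ s'(4)] unfolding runs_def by auto
    moreover have "(n - k) * (bcost b + T) = bcost b + T + m * (bcost b + T)"
      by (simp flip: Suc.hyps(2))
    ultimately show ?case
      using exec.WhileTrue[OF s'(1,2)] s'(3) unfolding runs_def
      by (intro exI[of _ "bcost b + t + u"] exI[of _ s'']) auto
  qed
  from this[of 0] init show ?thesis by simp
qed

lemma nmem_nwrite [simp]:
  "nmem (nwrite a i k s) = (nmem s)(a := (nmem s a)(i := k))"
  "rmem (nwrite a i k s) = rmem s"
  by (simp_all add: nwrite_def)

lemma rmem_rwrite [simp]:
  "rmem (rwrite a i r s) = (rmem s)(a := (rmem s a)(i := r))"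
  "nmem (rwrite a i r s) = nmem s"
  by (simp_all add: rwrite_def)

section \<open>The program\<close>

abbreviation nvar :: "string \<Rightarrow> nexp" where
  "nvar a \<equiv> NGet a (NConst 0)"

abbreviation rvar :: "string \<Rightarrow> rexp" where
  "rvar a \<equiv> RGet a (NConst 0)"

abbreviation nassign :: "string \<Rightarrow> nexp \<Rightarrow> com" where
  "nassign a e \<equiv> NSet a (NConst 0) e"

abbreviation rassign :: "string \<Rightarrow> rexp \<Rightarrow> com" where
  "rassign a e \<equiv> RSet a (NConst 0) e"

text \<open>Disjunction is expressed by De Morgan. Once \<open>w j < w i\<close> fails, equality
  amounts to the failure of \<open>w i < w j\<close>.\<close>

definition before_test :: "string \<Rightarrow> bexp" where
  "before_test w =
     BNot (BAnd (BNot (RLess (RGet w (nvar ''j'')) (RGet w (nvar ''i''))))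
       (BNot (BAnd (BNot (RLess (RGet w (nvar ''i'')) (RGet w (nvar ''j''))))
         (NLess (nvar ''j'') (nvar ''i'')))))"

definition rank_com :: "string \<Rightarrow> com" where
  "rank_com w =
     Seq (nassign ''r'' (NConst 0)) (Seq (nassign ''j'' (NConst 0))
       (While (NLess (nvar ''j'') (nvar ''n''))
         (Seq (Cond (before_test w) (nassign ''r'' (NAdd (nvar ''r'') (NConst 1))) Skip)
           (nassign ''j'' (NAdd (nvar ''j'') (NConst 1))))))"

text \<open>Besides the sorted copy \<open>z\<close> of \<open>w\<close>, the original positions, multiplied by the value
  of \<open>d\<close>, are recorded in \<open>y\<close>: with \<open>d = n\<close> these are the row offsets in the matching.\<close>

definition sort_com :: "string \<Rightarrow> nexp \<Rightarrow> string \<Rightarrow> string \<Rightarrow> com" where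
  "sort_com w d z y =
     Seq (nassign ''i'' (NConst 0)) (Seq (nassign ''c'' (NConst 0))
       (While (NLess (nvar ''i'') (nvar ''n''))
         (Seq (rank_com w)
         (Seq (RSet z (nvar ''r'') (RGet w (nvar ''i'')))
         (Seq (NSet y (nvar ''r'') (nvar ''c''))
         (Seq (nassign ''c'' (NAdd (nvar ''c'') d))
           (nassign ''i'' (NAdd (nvar ''i'') (NConst 1)))))))))"

text \<open>\<open>s\<close> is the running price and \<open>e\<close> the previous quality.
  Initially zero memory supplies their starting values and all zero entries of the matching, so only
  \<open>n\<close> ones are written.\<close>

definition price_com :: com where
  "price_com =
     Seq (nassign ''i'' (NConst 0))
       (While (NLess (nvar ''i'') (nvar ''n''))
         (Seq (NSet ''x'' (NAdd (NGet ''row'' (nvar ''i'')) (NGet ''col'' (nvar ''i''))) (NConst 1))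
         (Seq (rassign ''s'' (RAdd (rvar ''s'') (RMul (RGet ''V'' (nvar ''i''))
                 (RSub (RGet ''Q'' (nvar ''i'')) (rvar ''e'')))))
         (Seq (rassign ''e'' (RGet ''Q'' (nvar ''i'')))
         (Seq (RSet ''p'' (NGet ''col'' (nvar ''i'')) (rvar ''s''))
           (nassign ''i'' (NAdd (nvar ''i'') (NConst 1))))))))"

text \<open>Step \<open>n\<close> for buyers and 1 for items makes \<open>row l + col l\<close> the
  address of the matching entry for rank \<open>l\<close>.\<close>

definition main_com :: com where
  "main_com =
     Seq (sort_com ''v'' (nvar ''n'') ''V'' ''row'')
       (Seq (sort_com ''q'' (NConst 1) ''Q'' ''col'') price_com)"

section \<open>Correctness and running time of the program\<close>

lemma bval_before_test:
  "bval (before_test w) s \<longleftrightarrow> before (rmem s w) (nmem s ''j'' 0) (nmem s ''i'' 0)"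
  by (auto simp: before_test_def before_def)

lemma bcost_before_test: "bcost (before_test w) = 25"
  by (simp add: before_test_def)

lemma runs_rank_com:
  assumes "nmem s ''n'' 0 = n"
  shows "runs (rank_com w) s (60 * n + 20) (\<lambda>s'.
    nmem s' ''r'' 0 = rank n (rmem s w) (nmem s ''i'' 0) \<and> rmem s' = rmem s \<and>
    (\<forall>a. a \<notin> {''r'', ''j''} \<longrightarrow> nmem s' a = nmem s a))"
proof -
  define I where "I k s' \<longleftrightarrow>
    nmem s' ''r'' 0 = card {l. l < k \<and> before (rmem s w) l (nmem s ''i'' 0)} \<and>
    nmem s' ''j'' 0 = k \<and> rmem s' = rmem s \<and>
    (\<forall>a. a \<notin> {''r'', ''j''} \<longrightarrow> nmem s' a = nmem s a)" for k and s' :: state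
  have card_Suc: "card {l. l < Suc k \<and> R l} = card {l. l < k \<and> R l} + (if R k then 1 else 0)"
    for R and k :: nat
  proof -
    have "{l. l < Suc k \<and> R l} = {l. l < k \<and> R l} \<union> (if R k then {k} else {})"
      by (auto simp: less_Suc_eq)
    then show ?thesis by simp
  qed
  \<comment> \<open>The body costs at most 38, rounded up to 50; the guard costs 5.\<close>
  have "runs (rank_com w) s
    (1 + ncost (NConst 0) + ncost (NConst 0) + (1 + ncost (NConst 0) + ncost (NConst 0) +
      (n * (bcost (NLess (nvar ''j'') (nvar ''n'')) + 50) +
        bcost (NLess (nvar ''j'') (nvar ''n''))))) (I n)"
    unfolding rank_com_def
  proof (intro runs_Seq runs_NSet runs_While)
    fix k s' assume k: "k < n" "I k s'"
    show "bval (NLess (nvar ''j'') (nvar ''n'')) s' \<and>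
      runs (Seq (Cond (before_test w) (nassign ''r'' (NAdd (nvar ''r'') (NConst 1))) Skip)
           (nassign ''j'' (NAdd (nvar ''j'') (NConst 1)))) s' 50 (I (Suc k))"
    proof
      show "bval (NLess (nvar ''j'') (nvar ''n'')) s'"
        using k assms by (simp add: I_def)
      show "runs (Seq (Cond (before_test w) (nassign ''r'' (NAdd (nvar ''r'') (NConst 1))) Skip)
           (nassign ''j'' (NAdd (nvar ''j'') (NConst 1)))) s' 50 (I (Suc k))"
        by (rule runs_time, rule runs_Seq, (rule runs_Cond; (rule runs_NSet runs_Skip)+))
          (use k in \<open>simp_all add: bval_before_test bcost_before_test I_def card_Suc\<close>)
    qed
  qed (use assms in \<open>auto simp: I_def\<close>)
  then show ?thesis
    by (rule runs_conseq) (auto simp: I_def rank_def)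
qed

text \<open>The name conditions protect the loop variables and keep \<open>w\<close> intact while
  ranks are still being computed from it.\<close>

lemma runs_sort_com:
  assumes n: "nmem s ''n'' 0 = n"
    and d: "\<And>s. nmem s ''n'' 0 = n \<Longrightarrow> nval d s = D" "ncost d \<le> 2"
    and names: "y \<notin> {''n'', ''i'', ''j'', ''r'', ''c''}" "w \<noteq> z"
  shows "runs (sort_com w d z y) s (60 * n * n + 60 * n + 20) (\<lambda>s'.
    (\<forall>i<n. rmem s' z (rank n (rmem s w) i) = rmem s w i \<and>
      nmem s' y (rank n (rmem s w) i) = i * D) \<and>
    (\<forall>a. a \<noteq> z \<longrightarrow> rmem s' a = rmem s a) \<and>
    (\<forall>a. a \<notin> {''i'', ''j'', ''r'', ''c'', y} \<longrightarrow> nmem s' a = nmem s a))"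
proof -
  \<comment> \<open>\<open>c\<close> holds the product \<open>k * D\<close>, built by repeated
    addition since the naturals of the language have no multiplication.\<close>
  define I where "I k s' \<longleftrightarrow>
    nmem s' ''i'' 0 = k \<and> nmem s' ''c'' 0 = k * D \<and>
    (\<forall>i<k. rmem s' z (rank n (rmem s w) i) = rmem s w i \<and>
      nmem s' y (rank n (rmem s w) i) = i * D) \<and>
    (\<forall>a. a \<noteq> z \<longrightarrow> rmem s' a = rmem s a) \<and>
    (\<forall>a. a \<notin> {''i'', ''j'', ''r'', ''c'', y} \<longrightarrow> nmem s' a = nmem s a)" for k and s' :: state
  let ?b = "NLess (nvar ''i'') (nvar ''n'')"
  let ?d = "Seq (RSet z (nvar ''r'') (RGet w (nvar ''i'')))
         (Seq (NSet y (nvar ''r'') (nvar ''c''))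
         (Seq (nassign ''c'' (NAdd (nvar ''c'') d))
           (nassign ''i'' (NAdd (nvar ''i'') (NConst 1)))))"
  \<comment> \<open>Here the quadratic cost arises: each iteration contains a linear rank
    computation. The four assignments cost at most 24.\<close>
  have body: "bval ?b s' \<and> runs (Seq (rank_com w) ?d) s' (60 * n + 20 + 30) (I (Suc k))"
    if k: "k < n" "I k s'" for k s'
  proof
    have n': "nmem s' ''n'' 0 = n" using n k names by (auto simp: I_def)
    then show "bval ?b s'" using k by (simp add: I_def)
    have distinct: "rank n (rmem s w) k \<noteq> rank n (rmem s w) i" if "i < k" for i
      using k(1) that by (auto simp: inj_on_eq_iff[OF rank_inj])
    show "runs (Seq (rank_com w) ?d) s' (60 * n + 20 + 30) (I (Suc k))"
    proof (rule runs_Seq, rule runs_conseq[OF runs_rank_com[OF n']])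
      fix s'' :: state
      assume r: "nmem s'' ''r'' 0 = rank n (rmem s' w) (nmem s' ''i'' 0) \<and> rmem s'' = rmem s' \<and>
        (\<forall>a. a \<notin> {''r'', ''j''} \<longrightarrow> nmem s'' a = nmem s' a)"
      have w: "rmem s' w = rmem s w" using k names by (simp add: I_def)
      have r': "nmem s'' ''r'' 0 = rank n (rmem s w) k" "nmem s'' ''i'' 0 = k"
        "nmem s'' ''c'' 0 = k * D" "rmem s'' w = rmem s w"
        using r k w by (auto simp: I_def)
      have n'': "nmem s'' ''n'' 0 = n" using r n' by simp
      have y: "y \<noteq> ''n''" "y \<noteq> ''i''" "y \<noteq> ''j''" "y \<noteq> ''r''" "y \<noteq> ''c''"
        using names by auto
      show "runs ?d s'' 30 (I (Suc k))"
        by (rule runs_time, (rule runs_Seq runs_NSet runs_RSet)+)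
          (use k r r' n'' names(2) d(2) in
            \<open>simp_all add: I_def d(1) less_Suc_eq distinct distinct[symmetric]
              y y[symmetric] all_conj_distrib\<close>)
    qed simp
  qed
  have "runs (sort_com w d z y) s
    (1 + ncost (NConst 0) + ncost (NConst 0) + (1 + ncost (NConst 0) + ncost (NConst 0) +
      (n * (bcost ?b + (60 * n + 20 + 30)) + bcost ?b))) (I n)"
    unfolding sort_com_def
    by (intro runs_Seq runs_NSet runs_While body) (use n names in \<open>auto simp: I_def\<close>)
  then show ?thesis
    by (rule runs_conseq) (auto simp: I_def algebra_simps)
qed

text \<open>Injectivity of \<open>col\<close> ensures that no later write to \<open>p\<close>
  destroys an earlier price.\<close>

lemma runs_price_com:
  assumes n: "nmem s ''n'' 0 = n"
    and init: "nmem s ''x'' = (\<lambda>_. 0)" "rmem s ''s'' 0 = 0" "rmem s ''e'' 0 = 0"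
    and inj: "inj_on (nmem s ''col'') {..<n}"
  shows "runs price_com s (60 * n + 20) (\<lambda>s'.
    (\<forall>m. nmem s' ''x'' m =
      (if \<exists>l<n. m = nmem s ''row'' l + nmem s ''col'' l then 1 else 0)) \<and>
    (\<forall>l<n. rmem s' ''p'' (nmem s ''col'' l) = price (rmem s ''V'') (rmem s ''Q'') (Suc l)))"
proof -
  define I where "I k s' \<longleftrightarrow>
    nmem s' ''n'' 0 = n \<and> nmem s' ''i'' 0 = k \<and>
    nmem s' ''row'' = nmem s ''row'' \<and> nmem s' ''col'' = nmem s ''col'' \<and>
    rmem s' ''V'' = rmem s ''V'' \<and> rmem s' ''Q'' = rmem s ''Q'' \<and>
    rmem s' ''e'' 0 = case_nat 0 (rmem s ''Q'') k \<and>
    rmem s' ''s'' 0 = price (rmem s ''V'') (rmem s ''Q'') k \<and>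
    (\<forall>m. nmem s' ''x'' m =
      (if \<exists>l<k. m = nmem s ''row'' l + nmem s ''col'' l then 1 else 0)) \<and>
    (\<forall>l<k. rmem s' ''p'' (nmem s ''col'' l) = price (rmem s ''V'') (rmem s ''Q'') (Suc l))"
    for k and s' :: state
  let ?b = "NLess (nvar ''i'') (nvar ''n'')"
  have "runs price_com s
    (1 + ncost (NConst 0) + ncost (NConst 0) + (n * (bcost ?b + 50) + bcost ?b)) (I n)"
    unfolding price_com_def
  proof (intro runs_Seq runs_NSet runs_While conjI)
    fix k s' assume k: "k < n" "I k s'"
    show "bval ?b s'" using k by (simp add: I_def)
    have distinct: "nmem s ''col'' l \<noteq> nmem s ''col'' k" if "l < k" for l
      using k(1) that inj by (auto simp: inj_on_def)
    show "runs (Seq (NSet ''x'' (NAdd (NGet ''row'' (nvar ''i'')) (NGet ''col'' (nvar ''i''))) (NConst 1))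
         (Seq (rassign ''s'' (RAdd (rvar ''s'') (RMul (RGet ''V'' (nvar ''i''))
                 (RSub (RGet ''Q'' (nvar ''i'')) (rvar ''e'')))))
         (Seq (rassign ''e'' (RGet ''Q'' (nvar ''i'')))
         (Seq (RSet ''p'' (NGet ''col'' (nvar ''i'')) (rvar ''s''))
           (nassign ''i'' (NAdd (nvar ''i'') (NConst 1))))))) s' 50 (I (Suc k))"
      by (rule runs_time, (rule runs_Seq runs_NSet runs_RSet)+)
        (use k in \<open>auto simp: I_def less_Suc_eq distinct price_Suc\<close>)
  qed (use n init in \<open>auto simp: I_def\<close>)
  then show ?thesis by (rule runs_conseq) (auto simp: I_def)
qed

lemma main_com_correct:
  assumes "\<forall>j<n. q j > 0"
  shows "runs main_com (input_state n v q) (120 * n * n + 180 * n + 60)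
    (\<lambda>s. optimal n (\<lambda>i j. v i * q j) (output_matching n s) (output_prices s))"
proof -
  let ?s = "input_state n v q"
  let ?R = "\<lambda>s. optimal n (\<lambda>i j. v i * q j) (output_matching n s) (output_prices s)"
  \<comment> \<open>Ranks are computed from the arrays in memory, which agree with \<open>v\<close>
    and \<open>q\<close> below \<open>n\<close>.\<close>
  define v' where "v' = rmem ?s ''v''"
  define q' where "q' = rmem ?s ''q''"
  have s: "nmem ?s ''n'' 0 = n" "nmem ?s ''x'' = (\<lambda>_. 0)"
    "rmem ?s ''s'' = (\<lambda>_. 0)" "rmem ?s ''e'' = (\<lambda>_. 0)"
    by (auto simp: input_state_def)
  have vq: "v' i = v i" "q' i = q i" if "i < n" for i
    using that by (auto simp: v'_def q'_def input_state_def)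
  let ?\<rho> = "rank n v'" and ?\<sigma> = "rank n q'"
  have less: "?\<rho> i < n" "?\<sigma> i < n" if "i < n" for i
    using that by (simp_all add: rank_less)
  have onto: "\<exists>j<n. l = ?\<sigma> j" "\<exists>i<n. l = ?\<rho> i" if "l < n" for l
    using rank_bij[of n q'] rank_bij[of n v'] that unfolding bij_betw_def by (metis imageE lessThan_iff)+
  have "runs main_com ?s (60 * n * n + 60 * n + 20 + (60 * n * n + 60 * n + 20 + (60 * n + 20))) ?R"
    unfolding main_com_def
  proof (rule runs_Seq, rule runs_conseq[OF runs_sort_com[OF s(1), where D = n]],
      goal_cases _ _ _ _ _ sorted_v)
    case (sorted_v s1)
    then have s1: "nmem s1 ''n'' 0 = n" "nmem s1 ''x'' = (\<lambda>_. 0)"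
      "rmem s1 ''s'' = (\<lambda>_. 0)" "rmem s1 ''e'' = (\<lambda>_. 0)" "rmem s1 ''q'' = q'"
      "\<And>i. i < n \<Longrightarrow> rmem s1 ''V'' (?\<rho> i) = v' i"
      "\<And>i. i < n \<Longrightarrow> nmem s1 ''row'' (?\<rho> i) = i * n"
      using s by (auto simp: v'_def q'_def)
    show ?case
    proof (rule runs_Seq, rule runs_conseq[OF runs_sort_com[OF s1(1), where D = 1]],
        goal_cases _ _ _ _ _ sorted_q)
      case (sorted_q s2)
      then have s2: "nmem s2 ''n'' 0 = n" "nmem s2 ''x'' = (\<lambda>_. 0)"
        "rmem s2 ''s'' 0 = 0" "rmem s2 ''e'' 0 = 0"
        and V: "\<And>i. i < n \<Longrightarrow> rmem s2 ''V'' (?\<rho> i) = v' i"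
        and row: "\<And>i. i < n \<Longrightarrow> nmem s2 ''row'' (?\<rho> i) = i * n"
        and Q: "\<And>j. j < n \<Longrightarrow> rmem s2 ''Q'' (?\<sigma> j) = q' j"
        and col: "\<And>j. j < n \<Longrightarrow> nmem s2 ''col'' (?\<sigma> j) = j"
        using s1 by auto
      \<comment> \<open>\<open>col\<close> inverts the ranking of the items.\<close>
      have "inj_on (nmem s2 ''col'') {..<n}"
        using col onto(1) by (intro inj_onI) (metis lessThan_iff)
      then show ?case
      proof (rule runs_conseq[OF runs_price_com[OF s2]], goal_cases _ final)
        case (final s3)
        have x: "output_matching n s3 i j = (if ?\<rho> i = ?\<sigma> j then 1 else 0)"
          if ij: "i < n" "j < n" for i j
        proof -
          have "(\<exists>l<n. i * n + j = nmem s2 ''row'' l + nmem s2 ''col'' l) \<longleftrightarrow> ?\<rho> i = ?\<sigma> j"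
          proof
            assume "\<exists>l<n. i * n + j = nmem s2 ''row'' l + nmem s2 ''col'' l"
            then obtain l where l: "l < n" "i * n + j = nmem s2 ''row'' l + nmem s2 ''col'' l"
              by blast
            obtain i' j' where l': "i' < n" "l = ?\<rho> i'" "j' < n" "l = ?\<sigma> j'"
              using onto l(1) by metis
            then have eq: "i * n + j = i' * n + j'" using l(2) row col by metis
            \<comment> \<open>Since \<open>j\<close> and \<open>j'\<close> are below
              \<open>n\<close>, division with remainder recovers row and column from the
              address.\<close>
            then have "(i * n + j) div n = (i' * n + j') div n"
              "(i * n + j) mod n = (i' * n + j') mod n" by simp_all
            then have "i = i'" "j = j'" using ij l'(1,3) by simp_all
            then show "?\<rho> i = ?\<sigma> j" using l' by simp
          next
            assume "?\<rho> i = ?\<sigma> j"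
            then have "i * n + j = nmem s2 ''row'' (?\<rho> i) + nmem s2 ''col'' (?\<rho> i)"
              using row[OF ij(1)] col[OF ij(2)] by simp
            then show "\<exists>l<n. i * n + j = nmem s2 ''row'' l + nmem s2 ''col'' l"
              using less(1)[OF ij(1)] by blast
          qed
          then show ?thesis using final by (simp add: output_matching_def)
        qed
        have Qpos: "rmem s2 ''Q'' k > 0" if "k < n" for k
          using onto(1)[OF that] Q vq assms by auto
        show ?case
        proof (rule optimal_rank_matching[OF mono_on_sorted[of n _ v'] mono_on_sorted[of n _ q']
              Qpos rank_bij rank_bij])
          show "output_prices s3 j =
            price (rmem s2 ''V'') (rmem s2 ''Q'') (Suc (?\<sigma> j))" if "j < n" for j
            using final less(2)[OF that] col[OF that] by (metis output_prices_def)
        qed (use V Q vq x in auto)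
      qed auto
    qed auto
  qed auto
  then show ?thesis by (rule runs_conseq) (auto simp: algebra_simps)
qed

theorem theorem1:
  "\<exists>(c :: com) (T :: nat \<Rightarrow> nat).
     (\<lambda>n. real (T n)) \<in> O(\<lambda>n. (real n)\<^sup>2) \<and>
     (\<forall>(n :: nat) (v :: nat \<Rightarrow> real) (q :: nat \<Rightarrow> real).
        n \<ge> 1 \<longrightarrow> (\<forall>i<n. v i > 0) \<longrightarrow> (\<forall>j<n. q j > 0) \<longrightarrow>
        (\<exists>t s. exec c (input_state n v q) t s \<and> t \<le> T n \<and>
           optimal n (\<lambda>i j. v i * q j) (output_matching n s) (output_prices s)))"
proof (rule exI[of _ main_com], rule exI[of _ "\<lambda>n. 120 * n * n + 180 * n + 60"],
    intro conjI allI impI)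
  \<comment> \<open>The constant is 120 + 180 + 60, as \<open>n\<close> and 1 are at most
    \<open>n * n\<close>.\<close>
  have "real (120 * n * n + 180 * n + 60) \<le> 360 * (real n)\<^sup>2" if "n \<ge> 1" for n :: nat
  proof -
    have "n \<le> n * n" "1 \<le> n * n" using that by auto
    then have "120 * n * n + 180 * n + 60 \<le> 360 * (n * n)" unfolding mult.assoc by linarith
    then show ?thesis by (simp add: power2_eq_square flip: of_nat_mult of_nat_le_iff[where 'a = real])
  qed
  then show "(\<lambda>n. real (120 * n * n + 180 * n + 60)) \<in> O(\<lambda>n. (real n)\<^sup>2)"
    by (intro bigoI[of _ 360] eventually_sequentiallyI[of 1]) simp
next
  fix n :: nat and v q :: "nat \<Rightarrow> real"
  assume "\<forall>j<n. q j > 0"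
  from main_com_correct[OF this]
  show "\<exists>t s. exec main_com (input_state n v q) t s \<and> t \<le> 120 * n * n + 180 * n + 60 \<and>
    optimal n (\<lambda>i j. v i * q j) (output_matching n s) (output_prices s)"
    unfolding runs_def .
qed

end
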